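(* Let $G$ be a group, $X$ a Hausdorff locally compact paracompact space, $\varphi: G\curvearrowright X$ a properly discontinuous and cocompact action, and let $X+_fW\in Comp(X)$ be such that $\varphi$ extends continuously to an action on $X+_fW$. Then $X+_fW\in EPers_0(\varphi)$ if and only if $X+_fW\in Pers(\varepsilon_\varphi)$.
   Context: $Closed(X)$ is the set of closed subsets of $X$. A map $f:Closed(X)\to Closed(W)$ is admissible if $f(\emptyset)=\emptyset$ and $f(A\cup B)=f(A)\cup f(B)$; $X+_fW$ is the disjoint union $X\dot\cup W$ in which $C$ is closed iff $C\cap X$ is closed in $X$, $C\cap W$ is closed in $W$ and $f(C\cap X)\subseteq C$. $Comp(X)$ is the category of compact spaces $X+_fW$ with $W$ Hausdorff compact; morphisms are continuous maps that are the identity on $X$. A coarse structure on $X$ is a set of subsets of $X\times X$ containing the diagonal and closed under subsets, finite unions, inverses and compositions. An action by homeomorphisms is properly discontinuous if $\{g:\varphi(g,K)\cap K\neq\emptyset\}$ is finite for every compact $K$, and cocompact if $X/\varphi$ is compact. For $A\subseteq X$, $Sat(A)=\{(\varphi(g,x),\varphi(g,x')):g\in G,\ x,x'\in A\}$; $\varepsilon_\varphi$ is the coarse structure on $X$ generated by (smallest containing) all $Sat(A)$ with $A\subseteq X$ having compact closure. A Hausdorff compactification of $X$ is a compact Hausdorff space containing $X$ as a dense subspace. For a Hausdorff compactification $\bar X=X+_fW$, $\varepsilon_f$ denotes the coarse structure of all $e\subseteq X\times X$ with $Cl_{\bar X^2}(e)\cap(\bar X^2-X^2)\subseteq\{(w,w):w\in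 W\}$. For a coarse structure $\varepsilon$ on $X$ (coarsely connected and proper, as $\varepsilon_\varphi$ is), $X+_fW\in Pers(\varepsilon)$ means that $X+_fW$ is a Hausdorff compactification of $X$ with $\varepsilon\subseteq\varepsilon_f$ (coarse geometric perspectivity). $X+_fW\in EPers_0(\varphi)$ means that $\bar X=X+_fW$ is a Hausdorff compactification of $X$, $\varphi$ extends continuously to an action on $\bar X$, and for every entourage $u$ of the unique uniform structure compatible with the topology of $\bar X$ and every compact $K\subseteq X$ the set $\{g\in G:\varphi(g,K)\times\varphi(g,K)\not\subseteq u\}$ is finite (group theoretic perspectivity). *)

theory Defs
  imports "HOL-Analysis.Analysis" "HOL-Algebra.Group_Action"
begin

no_notation eq_closure_of (\<open>closure'_of\<index>\<close>)

section \<open>Topological preliminaries\<close>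

definition paracompact_space :: "'a topology \<Rightarrow> bool" where
  "paracompact_space X \<longleftrightarrow>
     (\<forall>\<U>. (\<forall>U\<in>\<U>. openin X U) \<and> \<Union>\<U> = topspace X \<longrightarrow>
        (\<exists>\<V>. (\<forall>V\<in>\<V>. openin X V) \<and> \<Union>\<V> = topspace X \<and>
             (\<forall>V\<in>\<V>. \<exists>U\<in>\<U>. V \<subseteq> U) \<and> locally_finite_in X \<V>))"

text \<open>\<open>Y\<close> is a Hausdorff compactification of \<open>X\<close>, where \<open>i\<close> is the inclusion of \<open>X\<close> as a
  dense subspace.\<close>

definition hausdorff_compactification :: "'a topology \<Rightarrow> ('a \<Rightarrow> 'b) \<Rightarrow> 'b topology \<Rightarrow> bool" where
  "hausdorff_compactification X i Y \<longleftrightarrow>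
     compact_space Y \<and> Hausdorff_space Y \<and> embedding_map X Y i \<and>
     Y closure_of (i ` topspace X) = topspace Y"


section \<open>The space \<open>X +\<^sub>f W\<close>\<close>

text \<open>Only the values of \<open>f\<close> on closed sets are relevant.\<close>

definition admissible :: "'a topology \<Rightarrow> 'b topology \<Rightarrow> ('a set \<Rightarrow> 'b set) \<Rightarrow> bool" where
  "admissible X W f \<longleftrightarrow>
     (\<forall>A. closedin X A \<longrightarrow> closedin W (f A)) \<and>
     f {} = {} \<and>
     (\<forall>A B. closedin X A \<and> closedin X B \<longrightarrow> f (A \<union> B) = f A \<union> f B)"

definition asum_closed ::
    "'a topology \<Rightarrow> ('a set \<Rightarrow> 'b set) \<Rightarrow> 'b topology \<Rightarrow> ('a + 'b) set \<Rightarrow> bool" where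
  "asum_closed X f W C \<longleftrightarrow>
     C \<subseteq> topspace X <+> topspace W \<and>
     closedin X (Inl -` C) \<and> closedin W (Inr -` C) \<and> f (Inl -` C) \<subseteq> Inr -` C"

text \<open>The set of open sets below is a topology as soon as \<open>f\<close> is admissible; see
  \<open>closedin_asum\<close> and \<open>topspace_asum\<close>.\<close>

definition asum ::
    "'a topology \<Rightarrow> ('a set \<Rightarrow> 'b set) \<Rightarrow> 'b topology \<Rightarrow> ('a + 'b) topology" where
  "asum X f W = topology (\<lambda>U. U \<subseteq> topspace X <+> topspace W \<and>
                              asum_closed X f W ((topspace X <+> topspace W) - U))"

lemma admissible_mono:
  assumes "admissible X W f" "closedin X A" "closedin X B" "A \<subseteq> B"
  shows "f A \<subseteq> f B"
proof -
  have "f (A \<union> B) = f A \<union> f B"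
    using assms by (simp add: admissible_def)
  then show ?thesis
    using assms(4) by (simp add: Un_absorb1 subset_Un_eq)
qed

lemma asum_closed_Inter:
  assumes f: "admissible X W f" and ne: "\<C> \<noteq> {}" and C: "\<And>C. C \<in> \<C> \<Longrightarrow> asum_closed X f W C"
  shows "asum_closed X f W (\<Inter>\<C>)"
proof -
  have l: "Inl -` (\<Inter>\<C>) = (\<Inter>C\<in>\<C>. Inl -` C)" and r: "Inr -` (\<Inter>\<C>) = (\<Inter>C\<in>\<C>. Inr -` C)"
    by auto
  have cl: "closedin X (Inl -` (\<Inter>\<C>))"
    unfolding l using ne C by (intro closedin_INT) (auto simp: asum_closed_def)
  have cr: "closedin W (Inr -` (\<Inter>\<C>))"
    unfolding r using ne C by (intro closedin_INT) (auto simp: asum_closed_def)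
  have "f (Inl -` (\<Inter>\<C>)) \<subseteq> Inr -` C" if "C \<in> \<C>" for C
  proof -
    have "f (Inl -` (\<Inter>\<C>)) \<subseteq> f (Inl -` C)"
      using that C by (intro admissible_mono[OF f cl]) (auto simp: asum_closed_def)
    then show ?thesis using C[OF that] by (auto simp: asum_closed_def)
  qed
  then have "f (Inl -` (\<Inter>\<C>)) \<subseteq> Inr -` (\<Inter>\<C>)"
    by blast
  moreover have "\<Inter>\<C> \<subseteq> topspace X <+> topspace W"
    using ne C unfolding asum_closed_def by blast
  ultimately show ?thesis
    using cl cr by (simp add: asum_closed_def)
qed

lemma asum_closed_Un:
  assumes "admissible X W f" "asum_closed X f W C" "asum_closed X f W D"
  shows "asum_closed X f W (C \<union> D)"
proof -
  have "f (Inl -` C \<union> Inl -` D) = f (Inl -` C) \<union> f (Inl -` D)"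
    using assms by (auto simp: admissible_def asum_closed_def)
  then show ?thesis
    using assms by (auto simp: asum_closed_def closedin_Un)
qed

lemma asum_closed_whole:
  assumes "admissible X W f"
  shows "asum_closed X f W (topspace X <+> topspace W)"
proof -
  have l: "Inl -` (topspace X <+> topspace W) = topspace X"
    and r: "Inr -` (topspace X <+> topspace W) = topspace W" by auto
  have "f (topspace X) \<subseteq> topspace W"
    using assms closedin_subset by (fastforce simp: admissible_def)
  then show ?thesis by (simp add: asum_closed_def l r)
qed

lemma asum_closed_empty: "admissible X W f \<Longrightarrow> asum_closed X f W {}"
  by (simp add: asum_closed_def admissible_def)

lemma openin_asum:
  assumes f: "admissible X W f"
  shows "openin (asum X f W) U \<longleftrightarrow> U \<subseteq> topspace X <+> topspace W \<and>
           asum_closed X f W ((topspace X <+> topspace W) - U)"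
proof -
  let ?S = "topspace X <+> topspace W"
  have "istopology (\<lambda>U. U \<subseteq> ?S \<and> asum_closed X f W (?S - U))"
    unfolding istopology_def
  proof (intro conjI allI impI)
    fix U V assume "U \<subseteq> ?S \<and> asum_closed X f W (?S - U)" "V \<subseteq> ?S \<and> asum_closed X f W (?S - V)"
    then show "asum_closed X f W (?S - U \<inter> V)" "U \<inter> V \<subseteq> ?S"
      using asum_closed_Un[OF f] by (simp_all add: Diff_Int le_infI1)
  next
    fix \<K> assume K: "\<forall>K\<in>\<K>. K \<subseteq> ?S \<and> asum_closed X f W (?S - K)"
    then show "\<Union>\<K> \<subseteq> ?S" by blast
    show "asum_closed X f W (?S - \<Union>\<K>)"
    proof (cases "\<K> = {}")
      case True
      then show ?thesis by (simp add: asum_closed_whole[OF f])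
    next
      case False
      then have "?S - \<Union>\<K> = \<Inter>((\<lambda>K. ?S - K) ` \<K>)" by blast
      then show ?thesis
        using asum_closed_Inter[OF f, of "(\<lambda>K. ?S - K) ` \<K>"] False K by auto
    qed
  qed
  then show ?thesis by (simp add: asum_def topology_inverse')
qed

lemma topspace_asum:
  assumes f: "admissible X W f"
  shows "topspace (asum X f W) = topspace X <+> topspace W"
proof
  show "topspace (asum X f W) \<subseteq> topspace X <+> topspace W"
    using openin_topspace[of "asum X f W"] unfolding openin_asum[OF f] by blast
  have "openin (asum X f W) (topspace X <+> topspace W)"
    using openin_asum[OF f] asum_closed_empty[OF f] by simp
  then show "topspace X <+> topspace W \<subseteq> topspace (asum X f W)"
    by (rule openin_subset)
qed

lemma closedin_asum:
  assumes f: "admissible X W f"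
  shows "closedin (asum X f W) C \<longleftrightarrow> asum_closed X f W C"
proof -
  have "C \<subseteq> topspace X <+> topspace W \<Longrightarrow>
        (topspace X <+> topspace W) - ((topspace X <+> topspace W) - C) = C" by blast
  then show ?thesis
    unfolding closedin_def topspace_asum[OF f] openin_asum[OF f]
    using asum_closed_def[of X f W C] by (metis Diff_subset)
qed

text \<open>\<open>X +\<^sub>f W\<close> is an object of \<open>Comp(X)\<close>.\<close>

definition Comp :: "'a topology \<Rightarrow> ('a set \<Rightarrow> 'b set) \<Rightarrow> 'b topology \<Rightarrow> bool" where
  "Comp X f W \<longleftrightarrow>
     admissible X W f \<and> compact_space W \<and> Hausdorff_space W \<and> compact_space (asum X f W)"


section \<open>Actions\<close>

text \<open>The group carries no topology. In \<open>group_action\<close> each \<open>\<phi> g\<close> is a bijection of the carrier,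
  extended by \<open>undefined\<close> outside of it.\<close>

definition action_by_homeos ::
    "('g, 'm) monoid_scheme \<Rightarrow> 'a topology \<Rightarrow> ('g \<Rightarrow> 'a \<Rightarrow> 'a) \<Rightarrow> bool" where
  "action_by_homeos G X \<phi> \<longleftrightarrow>
     group_action G (topspace X) \<phi> \<and> (\<forall>g\<in>carrier G. homeomorphic_map X X (\<phi> g))"

definition properly_discontinuous ::
    "('g, 'm) monoid_scheme \<Rightarrow> 'a topology \<Rightarrow> ('g \<Rightarrow> 'a \<Rightarrow> 'a) \<Rightarrow> bool" where
  "properly_discontinuous G X \<phi> \<longleftrightarrow>
     (\<forall>K. compactin X K \<longrightarrow> finite {g \<in> carrier G. \<phi> g ` K \<inter> K \<noteq> {}})"

definition orbit_space ::
    "('g, 'm) monoid_scheme \<Rightarrow> 'a topology \<Rightarrow> ('g \<Rightarrow> 'a \<Rightarrow> 'a) \<Rightarrow> 'a set topology" where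
  "orbit_space G X \<phi> =
     topology (\<lambda>\<O>. \<O> \<subseteq> orbits G (topspace X) \<phi> \<and>
                    openin X {x \<in> topspace X. orbit G \<phi> x \<in> \<O>})"

lemma openin_orbit_space:
  "openin (orbit_space G X \<phi>) \<O> \<longleftrightarrow>
     \<O> \<subseteq> orbits G (topspace X) \<phi> \<and> openin X {x \<in> topspace X. orbit G \<phi> x \<in> \<O>}"
proof -
  have "istopology (\<lambda>\<O>. \<O> \<subseteq> orbits G (topspace X) \<phi> \<and>
                    openin X {x \<in> topspace X. orbit G \<phi> x \<in> \<O>})"
    unfolding istopology_def
  proof (intro conjI allI impI)
    fix S T
    assume "S \<subseteq> orbits G (topspace X) \<phi> \<and> openin X {x \<in> topspace X. orbit G \<phi> x \<in> S}"
      "T \<subseteq> orbits G (topspace X) \<phi> \<and> openin X {x \<in> topspace X. orbit G \<phi> x \<in> T}"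
    moreover have "{x \<in> topspace X. orbit G \<phi> x \<in> S \<inter> T} =
        {x \<in> topspace X. orbit G \<phi> x \<in> S} \<inter> {x \<in> topspace X. orbit G \<phi> x \<in> T}" by blast
    ultimately show "openin X {x \<in> topspace X. orbit G \<phi> x \<in> S \<inter> T}"
      "S \<inter> T \<subseteq> orbits G (topspace X) \<phi>" by auto
  next
    fix \<K>
    assume K: "\<forall>K\<in>\<K>. K \<subseteq> orbits G (topspace X) \<phi> \<and> openin X {x \<in> topspace X. orbit G \<phi> x \<in> K}"
    have "{x \<in> topspace X. orbit G \<phi> x \<in> \<Union>\<K>} = (\<Union>K\<in>\<K>. {x \<in> topspace X. orbit G \<phi> x \<in> K})"
      by blast
    then show "openin X {x \<in> topspace X. orbit G \<phi> x \<in> \<Union>\<K>}"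
      using K by auto
    show "\<Union>\<K> \<subseteq> orbits G (topspace X) \<phi>" using K by blast
  qed
  then show ?thesis by (simp add: orbit_space_def topology_inverse')
qed

lemma topspace_orbit_space: "topspace (orbit_space G X \<phi>) = orbits G (topspace X) \<phi>"
proof
  show "topspace (orbit_space G X \<phi>) \<subseteq> orbits G (topspace X) \<phi>"
    using openin_topspace[of "orbit_space G X \<phi>"] unfolding openin_orbit_space by blast
  have "{x \<in> topspace X. orbit G \<phi> x \<in> orbits G (topspace X) \<phi>} = topspace X"
    by (auto simp: orbits_def)
  then have "openin (orbit_space G X \<phi>) (orbits G (topspace X) \<phi>)"
    by (simp add: openin_orbit_space)
  then show "orbits G (topspace X) \<phi> \<subseteq> topspace (orbit_space G X \<phi>)"
    by (rule openin_subset)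
qed

lemma quotient_map_orbit_space: "quotient_map X (orbit_space G X \<phi>) (orbit G \<phi>)"
  by (auto simp: quotient_map_def topspace_orbit_space openin_orbit_space orbits_def)

definition cocompact ::
    "('g, 'm) monoid_scheme \<Rightarrow> 'a topology \<Rightarrow> ('g \<Rightarrow> 'a \<Rightarrow> 'a) \<Rightarrow> bool" where
  "cocompact G X \<phi> \<longleftrightarrow> compact_space (orbit_space G X \<phi>)"

definition extends_to_action ::
    "('g, 'm) monoid_scheme \<Rightarrow> 'a topology \<Rightarrow> ('g \<Rightarrow> 'a \<Rightarrow> 'a) \<Rightarrow> ('a \<Rightarrow> 'b) \<Rightarrow> 'b topology \<Rightarrow> bool"
  where
  "extends_to_action G X \<phi> i Y \<longleftrightarrow>
     (\<exists>\<psi>. action_by_homeos G Y \<psi> \<and> (\<forall>g\<in>carrier G. \<forall>x\<in>topspace X. \<psi> g (i x) = i (\<phi> g x)))"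


section \<open>Coarse structures\<close>

definition coarse_structure :: "'a set \<Rightarrow> ('a \<times> 'a) set set \<Rightarrow> bool" where
  "coarse_structure S \<E> \<longleftrightarrow>
     (\<forall>e\<in>\<E>. e \<subseteq> S \<times> S) \<and>
     Id_on S \<in> \<E> \<and>
     (\<forall>e\<in>\<E>. \<forall>d. d \<subseteq> e \<longrightarrow> d \<in> \<E>) \<and>
     (\<forall>e\<in>\<E>. \<forall>d\<in>\<E>. e \<union> d \<in> \<E>) \<and>
     (\<forall>e\<in>\<E>. e\<inverse> \<in> \<E>) \<and>
     (\<forall>e\<in>\<E>. \<forall>d\<in>\<E>. e O d \<in> \<E>)"

definition generated_coarse_structure :: "'a set \<Rightarrow> ('a \<times> 'a) set set \<Rightarrow> ('a \<times> 'a) set set" where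
  "generated_coarse_structure S \<B> = \<Inter>{\<E>. coarse_structure S \<E> \<and> \<B> \<subseteq> \<E>}"

lemma coarse_structure_generated:
  assumes "\<B> \<subseteq> Pow (S \<times> S)"
  shows "coarse_structure S (generated_coarse_structure S \<B>)"
proof -
  have "coarse_structure S (Pow (S \<times> S))"
    unfolding coarse_structure_def by auto
  then have top: "Pow (S \<times> S) \<in> {\<E>. coarse_structure S \<E> \<and> \<B> \<subseteq> \<E>}"
    using assms by blast
  let ?F = "{\<E>. coarse_structure S \<E> \<and> \<B> \<subseteq> \<E>}"
  have cs: "coarse_structure S \<E>" if "\<E> \<in> ?F" for \<E> using that by blast
  have mem: "e \<in> generated_coarse_structure S \<B> \<longleftrightarrow> (\<forall>\<E>\<in>?F. e \<in> \<E>)" for e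
    by (simp add: generated_coarse_structure_def)
  show ?thesis
    unfolding coarse_structure_def
  proof (intro conjI ballI allI impI)
    fix e assume "e \<in> generated_coarse_structure S \<B>"
    then show "e \<subseteq> S \<times> S" using top mem by blast
  next
    show "Id_on S \<in> generated_coarse_structure S \<B>"
      unfolding mem using cs by (simp add: coarse_structure_def)
  next
    fix e d assume "e \<in> generated_coarse_structure S \<B>" "d \<subseteq> e"
    then show "d \<in> generated_coarse_structure S \<B>"
      unfolding mem using cs unfolding coarse_structure_def by meson
  next
    fix e d assume "e \<in> generated_coarse_structure S \<B>" "d \<in> generated_coarse_structure S \<B>"
    then show "e \<union> d \<in> generated_coarse_structure S \<B>" "e O d \<in> generated_coarse_structure S \<B>"
      unfolding mem using cs unfolding coarse_structure_def by meson+
  next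
    fix e assume "e \<in> generated_coarse_structure S \<B>"
    then show "e\<inverse> \<in> generated_coarse_structure S \<B>"
      unfolding mem using cs unfolding coarse_structure_def by meson
  qed
qed

definition Sat ::
    "('g, 'm) monoid_scheme \<Rightarrow> ('g \<Rightarrow> 'a \<Rightarrow> 'a) \<Rightarrow> 'a set \<Rightarrow> ('a \<times> 'a) set" where
  "Sat G \<phi> A = {(\<phi> g x, \<phi> g x') | g x x'. g \<in> carrier G \<and> x \<in> A \<and> x' \<in> A}"

definition action_coarse ::
    "('g, 'm) monoid_scheme \<Rightarrow> 'a topology \<Rightarrow> ('g \<Rightarrow> 'a \<Rightarrow> 'a) \<Rightarrow> ('a \<times> 'a) set set" where
  "action_coarse G X \<phi> =
     generated_coarse_structure (topspace X)
       {Sat G \<phi> A | A. A \<subseteq> topspace X \<and> compactin X (X closure_of A)}"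

text \<open>The closure is taken in \<open>\<open>X +\<^sub>f W\<close> \<times> \<open>X +\<^sub>f W\<close>\<close>, to which \<open>e \<subseteq> X \<times> X\<close> is transported along
  the inclusion \<open>Inl\<close>.\<close>

definition compactification_coarse ::
    "'a topology \<Rightarrow> ('a set \<Rightarrow> 'b set) \<Rightarrow> 'b topology \<Rightarrow> ('a \<times> 'a) set set" where
  "compactification_coarse X f W =
     {e. e \<subseteq> topspace X \<times> topspace X \<and>
         (prod_topology (asum X f W) (asum X f W) closure_of (map_prod Inl Inl ` e)) \<inter>
           (topspace (asum X f W) \<times> topspace (asum X f W)
              - (Inl ` topspace X) \<times> (Inl ` topspace X))
         \<subseteq> {(Inr w, Inr w) | w. w \<in> topspace W}}"


section \<open>Uniform structures\<close>

text \<open>The uniform spaces of the library are bound to a type class; here a uniform structure on a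
  set is given by its set of entourages.\<close>

definition uniform_structure :: "'a set \<Rightarrow> ('a \<times> 'a) set set \<Rightarrow> bool" where
  "uniform_structure S \<U> \<longleftrightarrow>
     S \<times> S \<in> \<U> \<and>
     (\<forall>u\<in>\<U>. Id_on S \<subseteq> u \<and> u \<subseteq> S \<times> S) \<and>
     (\<forall>u\<in>\<U>. \<forall>v. u \<subseteq> v \<and> v \<subseteq> S \<times> S \<longrightarrow> v \<in> \<U>) \<and>
     (\<forall>u\<in>\<U>. \<forall>v\<in>\<U>. u \<inter> v \<in> \<U>) \<and>
     (\<forall>u\<in>\<U>. u\<inverse> \<in> \<U>) \<and>
     (\<forall>u\<in>\<U>. \<exists>v\<in>\<U>. v O v \<subseteq> u)"

definition compatible_uniform_structure :: "'a topology \<Rightarrow> ('a \<times> 'a) set set \<Rightarrow> bool" where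
  "compatible_uniform_structure T \<U> \<longleftrightarrow>
     uniform_structure (topspace T) \<U> \<and>
     (\<forall>V. openin T V \<longleftrightarrow> V \<subseteq> topspace T \<and> (\<forall>x\<in>V. \<exists>u\<in>\<U>. u `` {x} \<subseteq> V))"

text \<open>Meaningful for compact Hausdorff \<open>T\<close>; see \<open>ex1_compatible_uniform_structure\<close>.\<close>

definition uniform_structure_of :: "'a topology \<Rightarrow> ('a \<times> 'a) set set" where
  "uniform_structure_of T = (THE \<U>. compatible_uniform_structure T \<U>)"

lemma uniform_structureD:
  assumes "uniform_structure S \<U>" "u \<in> \<U>"
  shows "Id_on S \<subseteq> u" "u \<subseteq> S \<times> S" "u\<inverse> \<in> \<U>" "\<exists>v\<in>\<U>. v O v \<subseteq> u"
    "\<And>v. v \<in> \<U> \<Longrightarrow> u \<inter> v \<in> \<U>" "\<And>v. u \<subseteq> v \<Longrightarrow> v \<subseteq> S \<times> S \<Longrightarrow> v \<in> \<U>"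
  using assms unfolding uniform_structure_def by meson+

lemma compatible_uniform_structure_openD:
  assumes "compatible_uniform_structure T \<U>"
  shows "openin T V \<longleftrightarrow> V \<subseteq> topspace T \<and> (\<forall>x\<in>V. \<exists>u\<in>\<U>. u `` {x} \<subseteq> V)"
  using assms unfolding compatible_uniform_structure_def by meson

lemma compatible_interior:
  assumes c: "compatible_uniform_structure T \<U>" and u: "u \<in> \<U>" and x: "x \<in> topspace T"
  obtains N where "openin T N" "x \<in> N" "N \<subseteq> u `` {x}"
proof
  have us: "uniform_structure (topspace T) \<U>"
    using c by (simp add: compatible_uniform_structure_def)
  let ?N = "{y \<in> topspace T. \<exists>w\<in>\<U>. w `` {y} \<subseteq> u `` {x}}"
  have "\<exists>v\<in>\<U>. v `` {y} \<subseteq> ?N" if y: "y \<in> ?N" for y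
  proof -
    from y obtain w where w: "w \<in> \<U>" "w `` {y} \<subseteq> u `` {x}" by blast
    obtain v where v: "v \<in> \<U>" "v O v \<subseteq> w"
      using uniform_structureD(4)[OF us w(1)] by blast
    have vs: "v \<subseteq> topspace T \<times> topspace T"
      using uniform_structureD(2)[OF us v(1)] .
    have "z \<in> ?N" if z: "(y, z) \<in> v" for z
    proof -
      have "v `` {z} \<subseteq> u `` {x}" using z v(2) w(2) by blast
      then show ?thesis using v(1) vs z by blast
    qed
    then show ?thesis using v(1) by blast
  qed
  then show "openin T ?N"
    unfolding compatible_uniform_structure_openD[OF c] by blast
  show "x \<in> ?N" using x u by blast
  show "?N \<subseteq> u `` {x}"
  proof
    fix y assume "y \<in> ?N"
    then obtain w where w: "y \<in> topspace T" "w \<in> \<U>" "w `` {y} \<subseteq> u `` {x}" by blast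
    have "Id_on (topspace T) \<subseteq> w" using uniform_structureD(1)[OF us w(2)] .
    then show "y \<in> u `` {x}" using w by blast
  qed
qed

lemma uniform_structure_refl:
  "uniform_structure S \<U> \<Longrightarrow> u \<in> \<U> \<Longrightarrow> x \<in> S \<Longrightarrow> (x, x) \<in> u"
  using uniform_structureD(1) by blast

lemma uniform_structure_Inter:
  assumes "uniform_structure S \<U>" "finite I" "\<And>i. i \<in> I \<Longrightarrow> u i \<in> \<U>"
  shows "S \<times> S \<inter> (\<Inter>i\<in>I. u i) \<in> \<U>"
  using assms(2,3)
proof (induction I rule: finite_induct)
  case empty
  then show ?case using assms(1) by (simp add: uniform_structure_def)
next
  case (insert i I)
  then have "u i \<inter> (S \<times> S \<inter> (\<Inter>i\<in>I. u i)) \<in> \<U>"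
    using uniform_structureD(5)[OF assms(1)] by simp
  moreover have "u i \<inter> (S \<times> S \<inter> (\<Inter>i\<in>I. u i)) = S \<times> S \<inter> (\<Inter>j\<in>insert i I. u j)" by blast
  ultimately show ?case by simp
qed

lemma openin_prod_boxE:
  assumes N: "openin (prod_topology T T) N" and ab: "(a, b) \<in> N"
  obtains A B where "openin T A" "openin T B" "a \<in> A" "b \<in> B" "A \<times> B \<subseteq> N"
proof -
  have "\<exists>A B. openin T A \<and> openin T B \<and> a \<in> A \<and> b \<in> B \<and> A \<times> B \<subseteq> N"
    using N[unfolded openin_prod_topology_alt, rule_format, OF ab] .
  then show ?thesis using that by (elim exE conjE)
qed

lemma openin_prod_Compl:
  assumes "closedin (prod_topology T T) C"
  shows "openin (prod_topology T T) (topspace T \<times> topspace T - C)"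
  using openin_diff[OF openin_topspace assms] by simp

lemma compatible_uniform_structure_eq:
  assumes comp: "compact_space T" and c: "compatible_uniform_structure T \<U>"
  shows "\<U> = {u. u \<subseteq> topspace T \<times> topspace T \<and>
               (\<exists>N. openin (prod_topology T T) N \<and> Id_on (topspace T) \<subseteq> N \<and> N \<subseteq> u)}"
    (is "_ = ?D")
proof
  have us: "uniform_structure (topspace T) \<U>"
    using c by (simp add: compatible_uniform_structure_def)
  show "\<U> \<subseteq> ?D"
  proof
    fix u assume u: "u \<in> \<U>"
    obtain v where v: "v \<in> \<U>" "v O v \<subseteq> u" using uniform_structureD(4)[OF us u] by blast
    define w where "w = v \<inter> v\<inverse>"
    have w: "w \<in> \<U>" unfolding w_def
      using uniform_structureD(5)[OF us v(1)] uniform_structureD(3)[OF us v(1)] by blast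
    have "\<forall>x\<in>topspace T. \<exists>N. openin T N \<and> x \<in> N \<and> N \<subseteq> w `` {x}"
      using compatible_interior[OF c w] by metis
    then obtain N where N: "\<And>x. x \<in> topspace T \<Longrightarrow> openin T (N x) \<and> x \<in> N x \<and> N x \<subseteq> w `` {x}"
      by metis
    define M where "M = (\<Union>x\<in>topspace T. N x \<times> N x)"
    have "openin (prod_topology T T) M"
      unfolding M_def using N by (intro openin_Union) (auto simp: openin_prod_Times_iff)
    moreover have "Id_on (topspace T) \<subseteq> M" using N unfolding M_def by blast
    moreover have "M \<subseteq> u"
    proof
      fix p assume "p \<in> M"
      then obtain x y z where "p = (y, z)" "x \<in> topspace T" "y \<in> N x" "z \<in> N x"
        unfolding M_def by blast
      then have "p = (y, z)" "(x, y) \<in> w" "(x, z) \<in> w" using N by blast+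
      then show "p \<in> u" using v(2) unfolding w_def by blast
    qed
    moreover have "u \<subseteq> topspace T \<times> topspace T"
      using uniform_structureD(2)[OF us u] .
    ultimately show "u \<in> ?D" by blast
  qed
  show "?D \<subseteq> \<U>"
  proof
    fix u assume "u \<in> ?D"
    then obtain M where us': "u \<subseteq> topspace T \<times> topspace T" and M: "openin (prod_topology T T) M"
      "Id_on (topspace T) \<subseteq> M" "M \<subseteq> u" by blast
    have "\<exists>v N. v \<in> \<U> \<and> openin T N \<and> x \<in> N \<and> N \<subseteq> v `` {x} \<and> (v O v) `` {x} \<times> (v O v) `` {x} \<subseteq> M"
      if x: "x \<in> topspace T" for x
    proof -
      have "(x, x) \<in> M" using M(2) x by blast
      then obtain A B where AB: "openin T A" "openin T B" "x \<in> A" "x \<in> B" "A \<times> B \<subseteq> M"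
        by (rule openin_prod_boxE[OF M(1)])
      have "openin T (A \<inter> B)" "x \<in> A \<inter> B" using AB by auto
      then obtain w where w: "w \<in> \<U>" "w `` {x} \<subseteq> A \<inter> B"
        using compatible_uniform_structure_openD[OF c, of "A \<inter> B"] by blast
      obtain v where v: "v \<in> \<U>" "v O v \<subseteq> w" using uniform_structureD(4)[OF us w(1)] by blast
      obtain N where "openin T N" "x \<in> N" "N \<subseteq> v `` {x}" using compatible_interior[OF c v(1) x] .
      moreover have "(v O v) `` {x} \<times> (v O v) `` {x} \<subseteq> M" using v(2) w(2) AB(5) by blast
      ultimately show ?thesis using v(1) by blast
    qed
    then obtain v N where vN: "\<And>x. x \<in> topspace T \<Longrightarrow> v x \<in> \<U> \<and> openin T (N x) \<and> x \<in> N x \<and>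
        N x \<subseteq> v x `` {x} \<and> (v x O v x) `` {x} \<times> (v x O v x) `` {x} \<subseteq> M" by metis
    have vU: "v x \<in> \<U>" and N_open: "openin T (N x)" and x_N: "x \<in> N x"
      and N_sub: "N x \<subseteq> v x `` {x}" and v_M: "(v x O v x) `` {x} \<times> (v x O v x) `` {x} \<subseteq> M"
      if "x \<in> topspace T" for x
      using vN[OF that] by simp_all
    have "(\<forall>U\<in>N ` topspace T. openin T U) \<and> topspace T \<subseteq> \<Union>(N ` topspace T)"
      using N_open x_N by blast
    then have "\<exists>\<F>. finite \<F> \<and> \<F> \<subseteq> N ` topspace T \<and> topspace T \<subseteq> \<Union>\<F>"
      using comp unfolding compact_space_def compactin_def by meson
    then obtain I where I: "finite I" "I \<subseteq> topspace T" "topspace T \<subseteq> (\<Union>x\<in>I. N x)"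
      by (metis finite_subset_image)
    let ?w = "topspace T \<times> topspace T \<inter> (\<Inter>x\<in>I. v x)"
    have w: "?w \<in> \<U>" 
      using I(2) vU by (intro uniform_structure_Inter[OF us I(1)]) blast
    have "?w \<subseteq> u"
    proof
      fix p assume p: "p \<in> ?w"
      then obtain y z where yz: "p = (y, z)" "y \<in> topspace T" by blast
      then obtain x where x: "x \<in> I" "y \<in> N x" using I(3) by blast
      then have xt: "x \<in> topspace T" using I(2) by blast
      have xy: "(x, y) \<in> v x" using N_sub[OF xt] x(2) by blast
      have yz': "(y, z) \<in> v x" using p x(1) yz(1) by blast
      have yy: "(y, y) \<in> v x" by (rule uniform_structure_refl[OF us vU[OF xt] yz(2)])
      have "y \<in> (v x O v x) `` {x}" using xy yy by blast
      moreover have "z \<in> (v x O v x) `` {x}" using xy yz' by blast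
      ultimately have "(y, z) \<in> M" using v_M[OF xt] by blast
      then show "p \<in> u" using M(3) yz by blast
    qed
    then show "u \<in> \<U>" using uniform_structureD(6)[OF us w] us' by blast
  qed
qed

lemma diagonal_neighbourhood_half:
  assumes comp: "compact_space T" and H: "Hausdorff_space T"
    and M: "openin (prod_topology T T) M" "Id_on (topspace T) \<subseteq> M"
  obtains N where "openin (prod_topology T T) N" "Id_on (topspace T) \<subseteq> N" "N O N \<subseteq> M"
proof -
  let ?S = "topspace T" and ?P = "prod_topology T T"
  let ?K = "?S \<times> ?S - M"
  have reg: "regular_space T"
    using comp H compact_Hausdorff_imp_regular_space by blast
  have clK: "closedin ?P ?K" 
    using closedin_diff[OF closedin_topspace M(1)] by simp
  have "compact_space ?P" using comp by (simp add: compact_space_prod_topology)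
  then have K: "compactin ?P ?K" using clK closedin_compact_space by blast
  have "\<exists>A B N. openin T A \<and> openin T B \<and> a \<in> A \<and> b \<in> B \<and> openin ?P N \<and> Id_on ?S \<subseteq> N \<and>
          (N O N) \<inter> (A \<times> B) = {}" if ab: "(a, b) \<in> ?K" for a b
  proof -
    have "a \<noteq> b" "a \<in> ?S" "b \<in> ?S" using ab M(2) by blast+
    then obtain P Q where PQ: "openin T P" "openin T Q" "a \<in> P" "b \<in> Q" "disjnt P Q"
      using H unfolding Hausdorff_space_def by blast
    obtain A CA where A: "openin T A" "closedin T CA" "a \<in> A" "A \<subseteq> CA" "CA \<subseteq> P"
      using reg PQ(1,3) unfolding neighbourhood_base_of_closedin[symmetric] neighbourhood_base_of by meson
    obtain B CB where B: "openin T B" "closedin T CB" "b \<in> B" "B \<subseteq> CB" "CB \<subseteq> Q"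
      using reg PQ(2,4) unfolding neighbourhood_base_of_closedin[symmetric] neighbourhood_base_of by meson
    let ?N = "?S \<times> ?S - (CA \<times> (?S - P)) - ((?S - Q) \<times> CB)"
    have "closedin T (?S - P)" "closedin T (?S - Q)"
      using PQ(1,2) by (simp_all add: closedin_diff)
    then have cl: "closedin ?P (CA \<times> (?S - P))" "closedin ?P ((?S - Q) \<times> CB)"
      unfolding closedin_prod_Times_iff using A(2) B(2) by simp_all
    have "openin ?P ?N"
      by (rule openin_diff[OF openin_prod_Compl[OF cl(1)] cl(2)])
    moreover have "Id_on ?S \<subseteq> ?N" using A(5) B(5) by blast
    moreover have "(?N O ?N) \<inter> (A \<times> B) = {}"
      using A(4) B(4) PQ(5) unfolding disjnt_def by blast
    ultimately show ?thesis using A B by blast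
  qed
  note box = this
  have "\<exists>R N. openin ?P R \<and> p \<in> R \<and> openin ?P N \<and> Id_on ?S \<subseteq> N \<and> (N O N) \<inter> R = {}"
    if p: "p \<in> ?K" for p
  proof -
    obtain a b where ab: "p = (a, b)" by (rule prod.exhaust)
    then obtain A B N where AB: "openin T A" "openin T B" "a \<in> A" "b \<in> B" "openin ?P N"
        "Id_on ?S \<subseteq> N" "(N O N) \<inter> (A \<times> B) = {}"
      using box[of a b] p by blast
    have "openin ?P (A \<times> B)" using AB(1,2) by (simp add: openin_prod_Times_iff)
    moreover have "p \<in> A \<times> B" using AB(3,4) ab by simp
    ultimately show ?thesis using AB(5-7) by blast
  qed
  then obtain R N where RN: "\<And>p. p \<in> ?K \<Longrightarrow>
      openin ?P (R p) \<and> p \<in> R p \<and> openin ?P (N p) \<and> Id_on ?S \<subseteq> N p \<and> (N p O N p) \<inter> R p = {}"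
    by metis
  have "(\<forall>U\<in>R ` ?K. openin ?P U) \<and> ?K \<subseteq> \<Union>(R ` ?K)" using RN by blast
  then have "\<exists>\<F>. finite \<F> \<and> \<F> \<subseteq> R ` ?K \<and> ?K \<subseteq> \<Union>\<F>"
    using K unfolding compactin_def by meson
  then obtain I where I: "finite I" "I \<subseteq> ?K" "?K \<subseteq> (\<Union>p\<in>I. R p)"
    by (metis finite_subset_image)
  let ?N = "?S \<times> ?S \<inter> (\<Inter>p\<in>I. N p)"
  show ?thesis
  proof
    show "openin ?P ?N"
    proof (cases "I = {}")
      case True
      then show ?thesis 
        using openin_topspace[of ?P] by simp
    next
      case False
      then have "openin ?P (\<Inter>p\<in>I. N p)" using I RN by (intro openin_INT2) auto
      then show ?thesis 
        using openin_Int[OF openin_topspace[of ?P]] by simp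
    qed
    show "Id_on ?S \<subseteq> ?N" using RN I(2) by blast
    show "?N O ?N \<subseteq> M"
    proof
      fix q assume q: "q \<in> ?N O ?N"
      show "q \<in> M"
      proof (rule ccontr)
        assume "q \<notin> M"
        then have "q \<in> ?K" using q by blast
        then obtain p where p: "p \<in> I" "q \<in> R p" using I(3) by blast
        then have "q \<in> N p O N p" using q by blast
        then show False using RN p I(2) by blast
      qed
    qed
  qed
qed

lemma compatible_uniform_structure_diagonal:
  assumes comp: "compact_space T" and H: "Hausdorff_space T"
  shows "compatible_uniform_structure T {u. u \<subseteq> topspace T \<times> topspace T \<and>
           (\<exists>N. openin (prod_topology T T) N \<and> Id_on (topspace T) \<subseteq> N \<and> N \<subseteq> u)}"
    (is "compatible_uniform_structure T ?D")
proof -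
  let ?S = "topspace T" and ?P = "prod_topology T T"
  have whole: "?S \<times> ?S \<in> ?D"
    using openin_topspace[of ?P] by (auto simp: topspace_prod_topology)
  have int: "u \<inter> v \<in> ?D" if uv: "u \<in> ?D" "v \<in> ?D" for u v
  proof -
    from uv obtain N M where "openin ?P N" "Id_on ?S \<subseteq> N" "N \<subseteq> u" "openin ?P M" "Id_on ?S \<subseteq> M" "M \<subseteq> v"
      by blast
    then have "openin ?P (N \<inter> M) \<and> Id_on ?S \<subseteq> N \<inter> M \<and> N \<inter> M \<subseteq> u \<inter> v" by blast
    then show ?thesis using uv by blast
  qed
  have conv: "u\<inverse> \<in> ?D" if u: "u \<in> ?D" for u
  proof -
    from u obtain N where N: "openin ?P N" "Id_on ?S \<subseteq> N" "N \<subseteq> u" by blast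
    have "openin ?P (N\<inverse>)"
      unfolding openin_prod_topology_alt
    proof (intro allI impI)
      fix y z assume "(y, z) \<in> N\<inverse>"
      then obtain A B where "openin T A" "openin T B" "z \<in> A" "y \<in> B" "A \<times> B \<subseteq> N"
        using openin_prod_boxE[OF N(1), of z y] by blast
      then show "\<exists>U V. openin T U \<and> openin T V \<and> y \<in> U \<and> z \<in> V \<and> U \<times> V \<subseteq> N\<inverse>" by blast
    qed
    moreover have "Id_on ?S \<subseteq> N\<inverse>" "N\<inverse> \<subseteq> u\<inverse>" using N by blast+
    ultimately show ?thesis using u by blast
  qed
  have half: "\<exists>v\<in>?D. v O v \<subseteq> u" if u: "u \<in> ?D" for u
  proof -
    from u obtain M where M: "openin ?P M" "Id_on ?S \<subseteq> M" "M \<subseteq> u" by blast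
    obtain N where N: "openin ?P N" "Id_on ?S \<subseteq> N" "N O N \<subseteq> M"
      using diagonal_neighbourhood_half[OF comp H M(1,2)] .
    have "N \<subseteq> ?S \<times> ?S" using openin_subset[OF N(1)] by (simp add: topspace_prod_topology)
    then have "N \<in> ?D" using N(1,2) by (intro CollectI conjI exI[of _ N]) simp_all
    moreover have "N O N \<subseteq> u" using N(3) M(3) by (rule subset_trans)
    ultimately show ?thesis by (rule bexI[rotated])
  qed
  have us: "uniform_structure ?S ?D"
    unfolding uniform_structure_def
  proof (intro conjI ballI allI impI)
    fix u v assume "u \<in> ?D" "u \<subseteq> v \<and> v \<subseteq> ?S \<times> ?S"
    then show "v \<in> ?D" by blast
  next
    show "?S \<times> ?S \<in> ?D" by (rule whole)
  next
    fix u assume u: "u \<in> ?D"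
    then show "Id_on ?S \<subseteq> u" "u \<subseteq> ?S \<times> ?S" by blast+
    show "u\<inverse> \<in> ?D" by (rule conv[OF u])
    show "\<exists>v\<in>?D. v O v \<subseteq> u" by (rule half[OF u])
    fix v assume "v \<in> ?D"
    with u show "u \<inter> v \<in> ?D" by (rule int)
  qed
  have "openin T V \<longleftrightarrow> V \<subseteq> ?S \<and> (\<forall>x\<in>V. \<exists>u\<in>?D. u `` {x} \<subseteq> V)" for V
  proof
    assume V: "openin T V"
    have "\<exists>u\<in>?D. u `` {x} \<subseteq> V" if x: "x \<in> V" for x
    proof -
      let ?u = "?S \<times> ?S - {x} \<times> (?S - V)"
      have "closedin T {x}" using H x openin_subset[OF V] by (simp add: closedin_Hausdorff_sing_eq subsetD)
      moreover have "closedin T (?S - V)" using V by (simp add: closedin_diff)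
      ultimately have "closedin ?P ({x} \<times> (?S - V))"
        unfolding closedin_prod_Times_iff by simp
      then have "openin ?P ?u" by (rule openin_prod_Compl)
      moreover have "Id_on ?S \<subseteq> ?u" using x by blast
      ultimately have "?u \<in> ?D" by (intro CollectI conjI exI[of _ ?u]) simp_all
      moreover have "?u `` {x} \<subseteq> V" by blast
      ultimately show ?thesis by (rule bexI[rotated])
    qed
    then show "V \<subseteq> ?S \<and> (\<forall>x\<in>V. \<exists>u\<in>?D. u `` {x} \<subseteq> V)" using openin_subset[OF V] by blast
  next
    assume V: "V \<subseteq> ?S \<and> (\<forall>x\<in>V. \<exists>u\<in>?D. u `` {x} \<subseteq> V)"
    have "\<exists>B. openin T B \<and> x \<in> B \<and> B \<subseteq> V" if x: "x \<in> V" for x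
    proof -
      obtain u where "u \<in> ?D" "u `` {x} \<subseteq> V" using V x by blast
      then obtain N where N: "openin ?P N" "Id_on ?S \<subseteq> N" "N `` {x} \<subseteq> V" by blast
      have "(x, x) \<in> N" using N(2) V x by blast
      then obtain A B where "openin T A" "openin T B" "x \<in> A" "x \<in> B" "A \<times> B \<subseteq> N"
        by (rule openin_prod_boxE[OF N(1)])
      then show ?thesis using N(3) by blast
    qed
    then show "openin T V" by (subst openin_subopen) blast
  qed
  with us show ?thesis unfolding compatible_uniform_structure_def by (intro conjI allI)
qed

lemma ex1_compatible_uniform_structure:
  assumes "compact_space T" "Hausdorff_space T"
  shows "\<exists>!\<U>. compatible_uniform_structure T \<U>"
  using compatible_uniform_structure_diagonal[OF assms] compatible_uniform_structure_eq[OF assms(1)]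
  by (rule ex1I[where P = "compatible_uniform_structure T"])

lemma compatible_uniform_structure_of:
  assumes "compact_space T" "Hausdorff_space T"
  shows "compatible_uniform_structure T (uniform_structure_of T)"
  unfolding uniform_structure_of_def
  by (rule theI'[OF ex1_compatible_uniform_structure[OF assms]])

section \<open>Perspectivity\<close>

text \<open>\<open>X +\<^sub>f W \<in> Pers(\<E>)\<close>.\<close>

definition Pers ::
    "('a \<times> 'a) set set \<Rightarrow> 'a topology \<Rightarrow> ('a set \<Rightarrow> 'b set) \<Rightarrow> 'b topology \<Rightarrow> bool" where
  "Pers \<E> X f W \<longleftrightarrow>
     Comp X f W \<and> hausdorff_compactification X Inl (asum X f W) \<and>
     \<E> \<subseteq> compactification_coarse X f W"

text \<open>\<open>X +\<^sub>f W \<in> EPers\<^sub>0(\<phi>)\<close>.\<close>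

definition EPers0 ::
    "('g, 'm) monoid_scheme \<Rightarrow> ('g \<Rightarrow> 'a \<Rightarrow> 'a) \<Rightarrow>
     'a topology \<Rightarrow> ('a set \<Rightarrow> 'b set) \<Rightarrow> 'b topology \<Rightarrow> bool" where
  "EPers0 G \<phi> X f W \<longleftrightarrow>
     Comp X f W \<and> hausdorff_compactification X Inl (asum X f W) \<and>
     extends_to_action G X \<phi> Inl (asum X f W) \<and>
     (\<forall>u \<in> uniform_structure_of (asum X f W). \<forall>K. compactin X K \<longrightarrow>
        finite {g \<in> carrier G. \<not> (Inl ` \<phi> g ` K) \<times> (Inl ` \<phi> g ` K) \<subseteq> u})"

end

theory Submission
  imports Defs
begin

text \<open>Both directions compare \<open>Sat G \<phi> K\<close> with an entourage \<open>u\<close> of the compactification \<open>Y\<close>. If only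
  finitely many translates of \<open>K\<close> are not \<open>u\<close>-small, then \<open>Sat G \<phi> K\<close> is contained in \<open>u\<close> up to
  finitely many compact squares in \<open>X \<times> X\<close>, so its closure can leave the diagonal only inside
  \<open>X \<times> X\<close> or inside the closure of \<open>u\<close>, and \<open>u\<close> is arbitrary. Conversely, if \<open>Sat G \<phi> K\<close> accumulates at
  the boundary only on the diagonal, then its part outside an open \<open>u\<close> has compact closure in
  \<open>X \<times> X\<close>, hence lies in some \<open>L \<times> L\<close> with \<open>L \<subseteq> X\<close> compact, and proper discontinuity applied to
  \<open>K \<union> L\<close> bounds the number of translates of \<open>K\<close> that are not \<open>u\<close>-small.\<close>

section \<open>Entourages and closed relations on a compact space\<close>

lemma uniform_structure_of_compact_Hausdorff:
  assumes "compact_space T" "Hausdorff_space T"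
  shows "uniform_structure_of T = {u. u \<subseteq> topspace T \<times> topspace T \<and>
           (\<exists>N. openin (prod_topology T T) N \<and> Id_on (topspace T) \<subseteq> N \<and> N \<subseteq> u)}"
  by (rule compatible_uniform_structure_eq[OF assms(1) compatible_uniform_structure_of[OF assms]])

lemma closedin_Id_on:
  "Hausdorff_space T \<Longrightarrow> closedin (prod_topology T T) (Id_on (topspace T))"
  by (simp add: Hausdorff_space_closedin_diagonal Id_on_def UNION_singleton_eq_range)

text \<open>A composition is the projection, along the coordinate of the middle point, of a closed
  set of triples. That coordinate ranges over a compact space, so the projection is a closed
  map.\<close>

lemma closedin_relcomp:
  assumes T: "compact_space T"
    and E: "closedin (prod_topology T T) E" and D: "closedin (prod_topology T T) D"
  shows "closedin (prod_topology T T) (E O D)"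
proof -
  let ?P = "prod_topology T T"
  let ?Z = "prod_topology T ?P"
  \<comment> \<open>In a triple \<open>(b, (a, c))\<close> of \<open>?Z\<close> the middle point
    \<open>b\<close> comes first, so that \<open>snd\<close> forgets exactly
    \<open>b\<close>.\<close>
  let ?C = "{z \<in> topspace ?Z. (fst (snd z), fst z) \<in> E} \<inter> {z \<in> topspace ?Z. (fst z, snd (snd z)) \<in> D}"
  have s: "continuous_map ?Z T (\<lambda>z. fst (snd z))" "continuous_map ?Z T (\<lambda>z. snd (snd z))"
    using continuous_map_compose[OF continuous_map_snd continuous_map_fst]
      continuous_map_compose[OF continuous_map_snd continuous_map_snd]
    by (simp_all add: o_def)
  have "continuous_map ?Z ?P (\<lambda>z. (fst (snd z), fst z))"
    "continuous_map ?Z ?P (\<lambda>z. (fst z, snd (snd z)))"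
    using s continuous_map_fst[of T ?P] by (simp_all add: continuous_map_paired)
  then have "closedin ?Z ?C"
    using closedin_continuous_map_preimage[OF _ E] closedin_continuous_map_preimage[OF _ D]
    by (intro closedin_Int) blast+
  then have "closedin ?P (snd ` ?C)"
    using closed_map_snd[OF T, of ?P] by (simp add: closed_map_def)
  moreover have "snd ` ?C = E O D"
  proof
    show "snd ` ?C \<subseteq> E O D" by auto
    show "E O D \<subseteq> snd ` ?C"
    proof clarify
      fix a b c assume abc: "(a, b) \<in> E" "(b, c) \<in> D"
      then have "(b, (a, c)) \<in> ?C"
        using closedin_subset[OF E] closedin_subset[OF D] by auto
      then show "(a, c) \<in> snd ` ?C" by (rule rev_image_eqI) simp
    qed
  qed
  ultimately show ?thesis by simp
qed

text \<open>The right-hand side is closed by \<open>closedin_relcomp\<close> and contains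
  \<open>e O d\<close>. It lets a limit of composed pairs be split at a middle point, possibly on
  the boundary.\<close>

lemma closure_of_relcomp:
  assumes "compact_space T" "e \<subseteq> topspace T \<times> topspace T" "d \<subseteq> topspace T \<times> topspace T"
  shows "prod_topology T T closure_of (e O d)
           \<subseteq> (prod_topology T T closure_of e) O (prod_topology T T closure_of d)"
  using assms
  by (intro closure_of_minimal closedin_relcomp relcomp_mono closure_of_subset) simp_all

lemma closedin_converse:
  assumes E: "closedin (prod_topology T T) E"
  shows "closedin (prod_topology T T) (E\<inverse>)"
proof -
  let ?P = "prod_topology T T"
  have "continuous_map ?P ?P (\<lambda>z. (snd z, fst z))"
    by (intro continuous_map_pairedI continuous_map_fst continuous_map_snd)
  then have "closedin ?P {z \<in> topspace ?P. (snd z, fst z) \<in> E}"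
    using E by (rule closedin_continuous_map_preimage)
  moreover have "{z \<in> topspace ?P. (snd z, fst z) \<in> E} = E\<inverse>"
    using closedin_subset[OF E] by auto
  ultimately show ?thesis by simp
qed

lemma closure_of_converse:
  assumes "e \<subseteq> topspace T \<times> topspace T"
  shows "prod_topology T T closure_of (e\<inverse>) \<subseteq> (prod_topology T T closure_of e)\<inverse>"
  using assms
  by (intro closure_of_minimal closedin_converse converse_mono[THEN iffD2] closure_of_subset) simp_all

section \<open>The coarse structure of a Hausdorff compactification\<close>

text \<open>The plain equation \<open>p = q\<close> can replace the boundary diagonal, because a
  diagonal point outside \<open>W\<close> lies in the square of \<open>X\<close> anyway.\<close>

lemma mem_compactification_coarse:
  assumes "admissible X W f"
  shows "e \<in> compactification_coarse X f W \<longleftrightarrow> e \<subseteq> topspace X \<times> topspace X \<and>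
    (\<forall>p q. (p, q) \<in> prod_topology (asum X f W) (asum X f W) closure_of (map_prod Inl Inl ` e) \<longrightarrow>
       p = q \<or> p \<in> Inl ` topspace X \<and> q \<in> Inl ` topspace X)"
proof -
  have "prod_topology (asum X f W) (asum X f W) closure_of A
      \<subseteq> (topspace X <+> topspace W) \<times> (topspace X <+> topspace W)" for A
    using closure_of_subset_topspace[of "prod_topology (asum X f W) (asum X f W)" A]
    by (simp add: topspace_asum[OF assms])
  then show ?thesis
    unfolding compactification_coarse_def topspace_asum[OF assms] by blast
qed

lemma coarse_structure_compactification_coarse:
  fixes X :: "'a topology" and W :: "'b topology"
  assumes f: "admissible X W f"
    and comp: "compact_space (asum X f W)" and H: "Hausdorff_space (asum X f W)"
  shows "coarse_structure (topspace X) (compactification_coarse X f W)"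
proof -
  let ?Y = "asum X f W" and ?i = "map_prod Inl Inl :: 'a \<times> 'a \<Rightarrow> ('a + 'b) \<times> ('a + 'b)"
  let ?P = "prod_topology ?Y ?Y"
  note mem = mem_compactification_coarse[OF f]
  have sub: "?i ` e \<subseteq> topspace ?Y \<times> topspace ?Y" if "e \<subseteq> topspace X \<times> topspace X" for e
    using that by (auto simp: topspace_asum[OF f])
  have Id: "Id_on (topspace X) \<in> compactification_coarse X f W"
  proof -
    have "closedin ?P (Id_on (topspace ?Y))"
      by (rule closedin_Id_on[OF H])
    moreover have "?i ` Id_on (topspace X) \<subseteq> Id_on (topspace ?Y)"
      by (auto simp: topspace_asum[OF f])
    ultimately have "?P closure_of (?i ` Id_on (topspace X)) \<subseteq> Id_on (topspace ?Y)"
      by (rule closure_of_minimal[rotated])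
    then show ?thesis unfolding mem by blast
  qed
  have mono: "d \<in> compactification_coarse X f W" if "e \<in> compactification_coarse X f W" "d \<subseteq> e" for e d
  proof -
    have "?P closure_of (?i ` d) \<subseteq> ?P closure_of (?i ` e)"
      using that(2) by (intro closure_of_mono image_mono)
    moreover have "d \<subseteq> topspace X \<times> topspace X" using that by (simp add: mem subset_trans)
    ultimately show ?thesis using that(1) unfolding mem by (meson subsetD)
  qed
  have Un: "e \<union> d \<in> compactification_coarse X f W"
    if "e \<in> compactification_coarse X f W" "d \<in> compactification_coarse X f W" for e d
  proof -
    have "?P closure_of (?i ` (e \<union> d)) = ?P closure_of (?i ` e) \<union> ?P closure_of (?i ` d)"
      by (simp only: image_Un closure_of_Un)
    then show ?thesis using that unfolding mem by (simp only: Un_iff Un_least) metis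
  qed
  have conv: "e\<inverse> \<in> compactification_coarse X f W" if e: "e \<in> compactification_coarse X f W" for e
  proof -
    have s: "?i ` e \<subseteq> topspace ?Y \<times> topspace ?Y" using e by (simp add: mem sub)
    have "?i ` (e\<inverse>) \<subseteq> (?i ` e)\<inverse>" by (auto intro: map_prod_imageI)
    then have "?P closure_of (?i ` (e\<inverse>)) \<subseteq> ?P closure_of ((?i ` e)\<inverse>)"
      by (rule closure_of_mono)
    also have "\<dots> \<subseteq> (?P closure_of (?i ` e))\<inverse>"
      by (rule closure_of_converse[OF s])
    finally have "?P closure_of (?i ` (e\<inverse>)) \<subseteq> \<dots>" .
    then show ?thesis using e unfolding mem by blast
  qed
  have relcomp: "e O d \<in> compactification_coarse X f W"
    if ed: "e \<in> compactification_coarse X f W" "d \<in> compactification_coarse X f W" for e d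
  proof -
    have s: "?i ` e \<subseteq> topspace ?Y \<times> topspace ?Y" "?i ` d \<subseteq> topspace ?Y \<times> topspace ?Y"
      using ed by (simp_all add: mem sub)
    have "?i ` (e O d) \<subseteq> ?i ` e O ?i ` d" by force
    then have "?P closure_of (?i ` (e O d)) \<subseteq> ?P closure_of (?i ` e O ?i ` d)"
      by (rule closure_of_mono)
    also have "\<dots> \<subseteq> (?P closure_of (?i ` e)) O (?P closure_of (?i ` d))"
      by (rule closure_of_relcomp[OF comp s])
    finally have cl: "?P closure_of (?i ` (e O d)) \<subseteq> \<dots>" .
    show ?thesis
      unfolding mem
    proof (intro conjI allI impI)
      show "e O d \<subseteq> topspace X \<times> topspace X" using ed by (auto simp: mem)
      fix p r assume "(p, r) \<in> ?P closure_of (?i ` (e O d))"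
      then obtain q where q: "(p, q) \<in> ?P closure_of (?i ` e)" "(q, r) \<in> ?P closure_of (?i ` d)"
        using cl by blast
      \<comment> \<open>If the middle point \<open>q\<close> is on the boundary, both pairs are
        diagonal and \<open>p = q = r\<close>; if \<open>q\<close> is in \<open>X\<close>, so are
        \<open>p\<close> and \<open>r\<close>.\<close>
      have "p = q \<or> p \<in> Inl ` topspace X \<and> q \<in> Inl ` topspace X"
        using ed(1) q(1) by (simp add: mem)
      moreover have "q = r \<or> q \<in> Inl ` topspace X \<and> r \<in> Inl ` topspace X"
        using ed(2) q(2) by (simp add: mem)
      ultimately show "p = r \<or> p \<in> Inl ` topspace X \<and> r \<in> Inl ` topspace X" by metis
    qed
  qed
  show ?thesis
    unfolding coarse_structure_def
  proof (intro conjI ballI allI impI)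
    show "e \<subseteq> topspace X \<times> topspace X" if "e \<in> compactification_coarse X f W" for e
      using that by (simp add: mem)
  qed (fact Id, erule (1) mono, erule (1) Un, erule conv, erule (1) relcomp)
qed

lemma generated_coarse_structure_minimal:
  assumes "coarse_structure S \<E>" "\<B> \<subseteq> \<E>"
  shows "generated_coarse_structure S \<B> \<subseteq> \<E>"
  unfolding generated_coarse_structure_def using assms by blast

lemma subset_generated_coarse_structure: "\<B> \<subseteq> generated_coarse_structure S \<B>"
  unfolding generated_coarse_structure_def by blast

section \<open>Translates of a compact set against entourages\<close>

text \<open>A forbidden limit pair \<open>(p, q)\<close> has a closed neighbourhood \<open>C\<close>
  missing the diagonal. The complement of \<open>C\<close> is an entourage, so only finitely many
  translates have squares meeting \<open>C\<close>, and their compact squares cannot accumulate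
  outside \<open>X \<times> X\<close>.\<close>

lemma Sat_mem_compactification_coarse:
  fixes X :: "'a topology" and W :: "'b topology"
  assumes X: "action_by_homeos G X \<phi>"
    and f: "admissible X W f"
    and Y: "hausdorff_compactification X Inl (asum X f W)"
    and K: "compactin X K"
    and small: "\<And>u. u \<in> uniform_structure_of (asum X f W) \<Longrightarrow>
       finite {g \<in> carrier G. \<not> (Inl ` \<phi> g ` K) \<times> (Inl ` \<phi> g ` K) \<subseteq> u}"
  shows "Sat G \<phi> K \<in> compactification_coarse X f W"
proof -
  let ?Y = "asum X f W" and ?i = "map_prod Inl Inl :: 'a \<times> 'a \<Rightarrow> ('a + 'b) \<times> ('a + 'b)"
  let ?P = "prod_topology ?Y ?Y"
  have Yc: "compact_space ?Y" and YH: "Hausdorff_space ?Y" and emb: "embedding_map X ?Y Inl"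
    using Y by (auto simp: hausdorff_compactification_def)
  have Inl: "continuous_map X ?Y Inl"
    using emb unfolding embedding_map_def
    by (meson continuous_map_into_fulltopology homeomorphic_imp_continuous_map)
  have cont: "continuous_map X X (\<phi> g)" if "g \<in> carrier G" for g
    using X that by (simp add: action_by_homeos_def homeomorphic_imp_continuous_map)
  have gK: "compactin X (\<phi> g ` K)" if "g \<in> carrier G" for g
    using K cont[OF that] image_compactin by blast
  have sub: "\<phi> g ` K \<subseteq> topspace X" if "g \<in> carrier G" for g
    using compactin_subset_topspace[OF gK[OF that]] .
  have Sat_sub: "Sat G \<phi> K \<subseteq> topspace X \<times> topspace X"
    using sub unfolding Sat_def by blast
  have "p = q \<or> p \<in> Inl ` topspace X \<and> q \<in> Inl ` topspace X"
    if pq: "(p, q) \<in> ?P closure_of (?i ` Sat G \<phi> K)" for p q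
  proof (rule ccontr)
    assume n: "\<not> (p = q \<or> p \<in> Inl ` topspace X \<and> q \<in> Inl ` topspace X)"
    have pqY: "(p, q) \<in> topspace ?P"
      by (rule subsetD[OF closure_of_subset_topspace pq])
    have "closedin ?P (Id_on (topspace ?Y))"
      by (rule closedin_Id_on[OF YH])
    then have "openin ?P (topspace ?P - Id_on (topspace ?Y))"
      by (rule openin_diff[OF openin_topspace])
    moreover have "(p, q) \<in> topspace ?P - Id_on (topspace ?Y)" using n pqY by blast
    moreover have "regular_space ?P"
      using Yc YH by (simp add: compact_Hausdorff_imp_regular_space regular_space_prod_topology)
    ultimately obtain U C where U: "openin ?P U" "closedin ?P C" "(p, q) \<in> U" "U \<subseteq> C"
        "C \<subseteq> topspace ?P - Id_on (topspace ?Y)"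
      unfolding neighbourhood_base_of_closedin[symmetric] neighbourhood_base_of by meson
    \<comment> \<open>An open set containing the diagonal, hence an entourage to which
      \<open>small\<close> applies.\<close>
    let ?u = "topspace ?P - C"
    have "openin ?P ?u" using U(2) by (rule openin_diff[OF openin_topspace])
    moreover have "Id_on (topspace ?Y) \<subseteq> ?u" using U(5) by auto
    ultimately have "?u \<in> uniform_structure_of ?Y"
      unfolding uniform_structure_of_compact_Hausdorff[OF Yc YH] by auto
    note fin = small[OF this]
    define F where "F = {g \<in> carrier G. \<not> (Inl ` \<phi> g ` K) \<times> (Inl ` \<phi> g ` K) \<subseteq> ?u}"
    define L where "L = (\<Union>g\<in>F. (Inl ` \<phi> g ` K) \<times> (Inl ` \<phi> g ` K) :: (('a + 'b) \<times> ('a + 'b)) set)"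
    have "closedin ?P ((Inl ` \<phi> g ` K) \<times> (Inl ` \<phi> g ` K))" if "g \<in> F" for g
    proof -
      have "compactin ?Y (Inl ` \<phi> g ` K)"
        using that by (intro image_compactin[OF gK Inl]) (simp add: F_def)
      then show ?thesis 
        using YH compactin_imp_closedin by (metis closedin_prod_Times_iff)
    qed
    then have "closedin ?P L"
      unfolding L_def using fin[folded F_def] by (intro closedin_Union) blast+
    then have "closedin ?P ((topspace ?P - U) \<union> L)"
      by (intro closedin_Un closedin_diff[OF closedin_topspace U(1)])
    \<comment> \<open>A \<open>?u\<close>-small translate has its square outside \<open>C\<close>,
      hence outside \<open>U\<close>; every other translate is indexed by \<open>F\<close> and is
      absorbed by \<open>L\<close>.\<close>
    moreover have "?i ` Sat G \<phi> K \<subseteq> (topspace ?P - U) \<union> L"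
    proof
      fix z assume "z \<in> ?i ` Sat G \<phi> K"
      then obtain g where g: "g \<in> carrier G" "z \<in> (Inl ` \<phi> g ` K) \<times> (Inl ` \<phi> g ` K)"
        unfolding Sat_def by auto
      then show "z \<in> (topspace ?P - U) \<union> L"
        using U(4) unfolding L_def F_def by blast
    qed
    ultimately have "?P closure_of (?i ` Sat G \<phi> K) \<subseteq> (topspace ?P - U) \<union> L"
      by (rule closure_of_minimal[rotated])
    \<comment> \<open>Since \<open>U\<close> is a neighbourhood of \<open>(p, q)\<close>, only
      \<open>L\<close> is left, and \<open>L\<close> lies in the square of \<open>X\<close>.\<close>
    then have "(p, q) \<in> L" using pq U(3) by blast
    then show False using n sub unfolding L_def F_def by blast
  qed
  then show ?thesis
    unfolding mem_compactification_coarse[OF f] using Sat_sub by blast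
qed

text \<open>The pairs of \<open>Sat G \<phi> K\<close> outside an open entourage stay away from the
  diagonal, so they have no limit pair on the boundary. They are thus confined to a compact part of
  \<open>X \<times> X\<close>, which proper discontinuity lets only finitely many translates
  reach.\<close>

lemma finite_not_small_translates:
  fixes X :: "'a topology" and W :: "'b topology"
  assumes pd: "properly_discontinuous G X \<phi>"
    and f: "admissible X W f"
    and Y: "hausdorff_compactification X Inl (asum X f W)"
    and K: "compactin X K"
    and S: "Sat G \<phi> K \<in> compactification_coarse X f W"
    and u: "u \<in> uniform_structure_of (asum X f W)"
  shows "finite {g \<in> carrier G. \<not> (Inl ` \<phi> g ` K) \<times> (Inl ` \<phi> g ` K) \<subseteq> u}"
proof -
  let ?Y = "asum X f W" and ?i = "map_prod Inl Inl :: 'a \<times> 'a \<Rightarrow> ('a + 'b) \<times> ('a + 'b)"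
  let ?P = "prod_topology ?Y ?Y"
  have Yc: "compact_space ?Y" and YH: "Hausdorff_space ?Y" and emb: "embedding_map X ?Y Inl"
    using Y by (auto simp: hausdorff_compactification_def)
  \<comment> \<open>Replacing \<open>u\<close> by an open \<open>N\<close> ensures that the closure
    of a set disjoint from \<open>N\<close> is still disjoint from \<open>N\<close>.\<close>
  obtain N where N: "openin ?P N" "Id_on (topspace ?Y) \<subseteq> N" "N \<subseteq> u"
    using u unfolding uniform_structure_of_compact_Hausdorff[OF Yc YH] by blast
  let ?e = "?i ` Sat G \<phi> K - N"
  let ?C = "?P closure_of ?e"
  have "?e \<subseteq> topspace ?P"
    using S unfolding mem_compactification_coarse[OF f] by (auto simp: topspace_asum[OF f])
  then have e_C: "?e \<subseteq> ?C" by (rule closure_of_subset)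
  have C_X: "?C \<subseteq> Inl ` topspace X \<times> Inl ` topspace X"
  proof
    fix z assume z: "z \<in> ?C"
    obtain p q where pq: "z = (p, q)" by (cases z)
    have "z \<in> ?P closure_of (?i ` Sat G \<phi> K)"
      using z closure_of_mono[of ?e "?i ` Sat G \<phi> K" ?P] by blast
    moreover have "?C \<inter> N = {}"
      using openin_Int_closure_of_eq_empty[OF N(1), of ?e] by blast
    then have "p \<noteq> q"
      using z N(2) pq closure_of_subset_topspace[of ?P ?e] by auto
    ultimately show "z \<in> Inl ` topspace X \<times> Inl ` topspace X"
      using S pq unfolding mem_compactification_coarse[OF f] by blast
  qed
  \<comment> \<open>The first projection is enough: one coordinate of a bad pair in \<open>L\<close>
    already makes the translate of \<open>K\<close> meet \<open>L\<close>.\<close>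
  define L where "L = Inl -` fst ` ?C"
  have L_img: "Inl ` L = fst ` ?C" using C_X unfolding L_def by force
  have L: "compactin X L"
  proof -
    have "compactin ?P ?C"
      using Yc by (intro closedin_compact_space) (simp_all add: compact_space_prod_topology)
    then have "compactin ?Y (Inl ` L)"
      unfolding L_img using continuous_map_fst image_compactin by blast
    moreover have "L \<subseteq> topspace X" using C_X unfolding L_def by force
    ultimately show ?thesis
      using emb unfolding embedding_map_def
      by (metis homeomorphic_map_compactness_eq compactin_subtopology image_mono)
  qed
  have "{g \<in> carrier G. \<not> (Inl ` \<phi> g ` K) \<times> (Inl ` \<phi> g ` K) \<subseteq> u}
      \<subseteq> {g \<in> carrier G. \<phi> g ` (K \<union> L) \<inter> (K \<union> L) \<noteq> {}}"
  proof clarify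
    fix g x y assume g: "g \<in> carrier G" "\<phi> g ` (K \<union> L) \<inter> (K \<union> L) = {}"
      and xy: "x \<in> K" "y \<in> K" "(Inl (\<phi> g x), Inl (\<phi> g y)) \<notin> u"
    have "(\<phi> g x, \<phi> g y) \<in> Sat G \<phi> K" using g xy unfolding Sat_def by blast
    then have "(Inl (\<phi> g x), Inl (\<phi> g y)) \<in> ?e" using N(3) xy(3) by force
    then have "\<phi> g x \<in> L" using e_C unfolding L_def by force
    then show False using g xy by blast
  qed
  moreover have "finite {g \<in> carrier G. \<phi> g ` (K \<union> L) \<inter> (K \<union> L) \<noteq> {}}"
    using pd compactin_Un[OF K L] unfolding properly_discontinuous_def by blast
  ultimately show ?thesis by (rule finite_subset)
qed

theorem proposition2p6:
  fixes G :: "('g, 'm) monoid_scheme"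
    and X :: "'a topology" and W :: "'b topology"
    and \<phi> :: "'g \<Rightarrow> 'a \<Rightarrow> 'a" and f :: "'a set \<Rightarrow> 'b set"
  assumes "group G"
    and "Hausdorff_space X" and "locally_compact_space X" and "paracompact_space X"
    and "action_by_homeos G X \<phi>"
    and "properly_discontinuous G X \<phi>" and "cocompact G X \<phi>"
    and "Comp X f W"
    and "extends_to_action G X \<phi> Inl (asum X f W)"
  shows "EPers0 G \<phi> X f W \<longleftrightarrow> Pers (action_coarse G X \<phi>) X f W"
proof
  have f: "admissible X W f" using \<open>Comp X f W\<close> by (simp add: Comp_def)
  show "Pers (action_coarse G X \<phi>) X f W" if E: "EPers0 G \<phi> X f W"
  proof -
    have Y: "hausdorff_compactification X Inl (asum X f W)" using E by (simp add: EPers0_def)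
    then have coarse: "coarse_structure (topspace X) (compactification_coarse X f W)"
      by (intro coarse_structure_compactification_coarse f) (auto simp: hausdorff_compactification_def)
    have "Sat G \<phi> A \<in> compactification_coarse X f W"
      if A: "A \<subseteq> topspace X" "compactin X (X closure_of A)" for A
    proof -
      \<comment> \<open>The smallness condition speaks of compact sets only, so it is applied to the
        closure of \<open>A\<close>; closure under subsets then returns to \<open>A\<close>.\<close>
      have "Sat G \<phi> (X closure_of A) \<in> compactification_coarse X f W"
        using E A(2) by (intro Sat_mem_compactification_coarse[OF assms(5) f Y]) (auto simp: EPers0_def)
      moreover have "Sat G \<phi> A \<subseteq> Sat G \<phi> (X closure_of A)"
        using closure_of_subset[OF A(1)] unfolding Sat_def by blast
      ultimately show ?thesis using coarse unfolding coarse_structure_def by blast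
    qed
    then have "action_coarse G X \<phi> \<subseteq> compactification_coarse X f W"
      unfolding action_coarse_def by (intro generated_coarse_structure_minimal[OF coarse]) blast
    then show ?thesis using Y \<open>Comp X f W\<close> by (simp add: Pers_def)
  qed
  show "EPers0 G \<phi> X f W" if P: "Pers (action_coarse G X \<phi>) X f W"
  proof -
    have Y: "hausdorff_compactification X Inl (asum X f W)"
      and sub: "action_coarse G X \<phi> \<subseteq> compactification_coarse X f W"
      using P by (simp_all add: Pers_def)
    have "Sat G \<phi> K \<in> compactification_coarse X f W" if K: "compactin X K" for K
    proof -
      \<comment> \<open>In a Hausdorff space a compact \<open>K\<close> is its own closure, which
        makes \<open>Sat G \<phi> K\<close> one of the generators.\<close>
      have "X closure_of K = K"
        using K compactin_imp_closedin[OF \<open>Hausdorff_space X\<close>] by (simp add: closure_of_closedin)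
      then have "Sat G \<phi> K \<in> action_coarse G X \<phi>"
        unfolding action_coarse_def
        using K compactin_subset_topspace[OF K] by (intro subsetD[OF subset_generated_coarse_structure]) auto
      then show ?thesis using sub by blast
    qed
    then show ?thesis
      using finite_not_small_translates[OF assms(6) f Y] Y assms(8,9) by (auto simp: EPers0_def)
  qed
qed

end
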